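(* In the setting described in the context, suppose that for every mesh parameter $h$ the functional $v^h\mapsto\mathcal G^h(v^h;q)$ has a minimizer $u^h$ over $\mathcal U^h$, with Helmholtz decomposition $\boldsymbol f(u^h)=\nabla q_{u^h}+\nabla^\perp\psi_{u^h}$. Assume that there are constants $C,c,\varkappa,\alpha>0$, independent of $h$, with $\varkappa>\alpha$, such that $$\|\nabla_{\mathfrak d}\cdot\boldsymbol f(u^h)-\ell_d\|_{-1,\Gamma_C}=\|\nabla(q_{u^h}-q)\|\le Ch^\varkappa$$ and $$\inf_{0\ne\boldsymbol s^h\in\boldsymbol{\mathcal S}^h}\ \sup_{0\ne p\in H^1_{0,\Gamma_C}(\Omega)}\frac{|(\boldsymbol s^h,\nabla p)|}{\|\boldsymbol s^h\|\,\|\nabla p\|}\ge ch^\alpha,\qquad\boldsymbol{\mathcal S}^h=\operatorname{span}\{\boldsymbol f(v^h):v^h\in\mathcal U^h\}\subset[L^2(\Omega)]^2,$$ and that the spaces $\mathcal U^h$ form an increasing sequence of nested spaces as $h\to0$. Then $\boldsymbol f(u^h)$ converges, with a rate $\mathcal O(h^{\varkappa-\alpha})$, in $[L^2(\Omega)]^2$ as $h\to0$.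
   Context: **Domain and spaces.** $\Omega\subset\mathbb R^2$ (coordinates $(t,x)$) is open, bounded, simply connected with Lipschitz boundary $\Gamma$ and unit outward normal $\boldsymbol n$. $\nabla v=[\partial_t v,\partial_x v]$, $\nabla^\perp v=[\partial_x v,-\partial_t v]$. $\|\cdot\|$ and $(\cdot,\cdot)$ are the norm and inner product in $L^2(\Omega)$ and $[L^2(\Omega)]^2$. $\Gamma=\overline{\Gamma_I}\cup\overline{\Gamma_C}$, where $\Gamma_I$ (the inflow part of the boundary, regarded as known) and its complement part $\Gamma_C$ are disjoint relatively open subcurves of nonzero measure with finitely many connected components. For $\Gamma_S\subset\Gamma$, $H^1_{0,\Gamma_S}(\Omega)=\{\phi\in H^1(\Omega):\phi=0\text{ on }\Gamma_S\}$ with norm $|\phi|_1=\|\nabla\phi\|$; its dual is $H^{-1}_{\Gamma_S}(\Omega)$ with norm $\|\ell\|_{-1,\Gamma_S}=\sup_{0\ne\phi\in H^1_{0,\Gamma_S}(\Omega)}|\ell(\phi)|/|\phi|_1$. **Duality divergence.** For $\boldsymbol v\in[L^2(\Omega)]^2$, $\nabla_{\mathfrak d}\cdot\boldsymbol v\in H^{-1}_{\Gamma_C}(\Omega)$ is the functional $\phi\mapsto-(\boldsymbol v,\nabla\phi)$, $\phi\in H^1_{0,\Gamma_C}(\Omega)$. **Helmholtz decomposition.** Every $\boldsymbol v\in[L^2(\Omega)]^2$ has a unique $L^2$-orthogonal decomposition $\boldsymbol v=\nabla q_{\boldsymbol v}+\nabla^\perp\psi_{\boldsymbol v}$ with $q_{\boldsymbol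 v}\in H^1_{0,\Gamma_C}(\Omega)$ and $\psi_{\boldsymbol v}\in H^1_{0,\Gamma_I}(\Omega)$, where $(\nabla q_{\boldsymbol v},\nabla\phi)=(\boldsymbol v,\nabla\phi)$ for all $\phi\in H^1_{0,\Gamma_C}(\Omega)$ and $(\nabla^\perp\psi_{\boldsymbol v},\nabla^\perp\nu)=(\boldsymbol v,\nabla^\perp\nu)$ for all $\nu\in H^1_{0,\Gamma_I}(\Omega)$. For $v\in L^\infty(\Omega)$ write $\boldsymbol f(v)=\nabla q_v+\nabla^\perp\psi_v$ for the decomposition of $\boldsymbol f(v)$. **Balance law.** $\nabla\cdot\boldsymbol f(u)=r$ in $\Omega$, $u=g$ on $\Gamma_I$, with $r\in L^2(\Omega)$, $g\in L^\infty(\Gamma_I)$, and $\boldsymbol f=[f_1,f_2]:\mathbb R\to\mathbb R^2$ locally Lipschitz (for every compact $J\subset\mathbb R$ there is $K_{\boldsymbol f,J}>0$ with $|f_i(a)-f_i(b)|\le K_{\boldsymbol f,J}|a-b|$ for $a,b\in J$, $i=1,2$). The data functional $\ell_d\in H^{-1}_{\Gamma_C}(\Omega)$ is $\ell_d(\phi)=(r,\phi)-\int_{\Gamma_I}\boldsymbol f(g)\cdot\boldsymbol n\,\phi\,d\sigma$. A function $\hat u\in L^\infty(\Omega)$ is a weak solution if $-(\boldsymbol f(\hat u),\nabla\phi)=\ell_d(\phi)$ for all $\phi\in H^1_{0,\Gamma_C}(\Omega)$; $\hat u$ denotes a fixed weak solution (assumed to exist). The function $q\in H^1_{0,\Gamma_C}(\Omega)$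 is the gradient component in $\boldsymbol f(\hat u)=\nabla q+\nabla^\perp\psi$; equivalently, it is the unique solution of $(\nabla q,\nabla\phi)=-\ell_d(\phi)$ for all $\phi\in H^1_{0,\Gamma_C}(\Omega)$. **Functionals.** For each mesh parameter $h$, $\mathcal U^h\subset L^\infty(\Omega)$, $\mathcal V^h_{\Gamma_C}\subset H^1_{0,\Gamma_C}(\Omega)$, $\mathcal V^h_{\Gamma_I}\subset H^1_{0,\Gamma_I}(\Omega)$ are finite element spaces. For $v\in L^\infty(\Omega)$, $p\in H^1_{0,\Gamma_C}(\Omega)$, $\mu\in H^1_{0,\Gamma_I}(\Omega)$, $$\mathcal F(v,p,\mu;q)=\|\boldsymbol f(v)-\nabla p-\nabla^\perp\mu\|^2+\|\nabla p-\nabla q\|^2,\qquad \mathcal G^h(v;q)=\min_{p^h\in\mathcal V^h_{\Gamma_C},\,\mu^h\in\mathcal V^h_{\Gamma_I}}\mathcal F(v,p^h,\mu^h;q).$$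
   Formalization: The mesh parameters h are assumed to tend to 0 with ratios of successive values bounded below (automatic if h ranges over an interval (0,h0]); for arbitrarily fast decreasing sequences of h the claim fails. *)

theory Defs
  imports "HOL-Analysis.Analysis" "HOL-Library.Landau_Symbols" "HOL-Library.Function_Algebras"
begin

text \<open>Coordinates in the plane are $(t,x)$: component 1 is $t$, component 2 is $x$.
  Elements of Lebesgue and Sobolev spaces are represented by functions; equality in those spaces is
  equality almost everywhere.\<close>

type_synonym plane = "real^2"


subsection \<open>Linear structure on functions (pointwise)\<close>

global_interpretation fun_vs: vector_space "\<lambda>(c::real) (v::'a \<Rightarrow> 'b::real_vector) x. c *\<^sub>R v x"
  by unfold_locales (auto simp: fun_eq_iff scaleR_add_right scaleR_add_left)

text \<open>Finite element spaces enter only as finite-dimensional linear spaces of functions.\<close>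

definition fe_space :: "(plane \<Rightarrow> real) set \<Rightarrow> bool" where
  "fe_space V \<longleftrightarrow> (\<exists>B. finite B \<and> V = fun_vs.span B)"


subsection \<open>Lebesgue spaces\<close>

definition L2 :: "plane measure \<Rightarrow> (plane \<Rightarrow> 'b::euclidean_space) set" where
  "L2 M = {v. v \<in> borel_measurable M \<and> integrable M (\<lambda>z. (norm (v z))\<^sup>2)}"

definition Linf :: "plane measure \<Rightarrow> (plane \<Rightarrow> real) set" where
  "Linf M = {v. v \<in> borel_measurable M \<and> (\<exists>K. AE z in M. \<bar>v z\<bar> \<le> K)}"

definition l2_norm :: "plane measure \<Rightarrow> (plane \<Rightarrow> 'b::euclidean_space) \<Rightarrow> real" where
  "l2_norm M v = sqrt (LINT z|M. (norm (v z))\<^sup>2)"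

definition l2_inner ::
  "plane measure \<Rightarrow> (plane \<Rightarrow> 'b::euclidean_space) \<Rightarrow> (plane \<Rightarrow> 'b) \<Rightarrow> real" where
  "l2_inner M v w = (LINT z|M. v z \<bullet> w z)"


subsection \<open>Domain and boundary\<close>

text \<open>Near each boundary point, in suitable orthonormal coordinates centred at that point, the set is
  the strict subgraph of a Lipschitz function.\<close>

definition lipschitz_boundary :: "plane set \<Rightarrow> bool" where
  "lipschitz_boundary \<Omega> \<longleftrightarrow>
     (\<forall>z\<in>frontier \<Omega>. \<exists>a b \<rho> L. \<exists>\<gamma>::real \<Rightarrow> real.
        norm a = 1 \<and> norm b = 1 \<and> a \<bullet> b = 0 \<and> \<rho> > 0 \<and> L-lipschitz_on UNIV \<gamma> \<and>
        (\<forall>y\<in>ball z \<rho>. y \<in> \<Omega> \<longleftrightarrow> (y - z) \<bullet> b < \<gamma> ((y - z) \<bullet> a)))"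

text \<open>Arc length is the one-dimensional Hausdorff measure; in dimension one the usual normalising
  factor is 1. Since \<^const>\<open>diameter\<close> is only meaningful for bounded sets, covers consist of bounded
  sets.\<close>

definition hausdorff_outer :: "plane set \<Rightarrow> ennreal" where
  "hausdorff_outer A = (SUP \<delta>\<in>{0<..}.
     INF C\<in>{C::nat \<Rightarrow> plane set.
              A \<subseteq> (\<Union>i. C i) \<and> (\<forall>i. bounded (C i) \<and> diameter (C i) \<le> \<delta>)}.
       (\<Sum>i. ennreal (diameter (C i))))"

definition hausdorff :: "plane measure" where
  "hausdorff = measure_of UNIV (sets borel) hausdorff_outer"

definition bd_measure :: "plane set \<Rightarrow> plane measure" where
  "bd_measure \<Omega> = completion (restrict_space hausdorff (frontier \<Omega>))"

text \<open>The outward unit normal is described by blow-up: for every aperture, the open cone around \<open>- n\<close>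
  lies locally in the domain and the one around \<open>n\<close> lies locally outside its closure. On a Lipschitz
  boundary this determines the normal at every point where the local graph is differentiable, hence
  almost everywhere with respect to arc length.\<close>

definition is_outward_normal :: "plane set \<Rightarrow> plane \<Rightarrow> plane \<Rightarrow> bool" where
  "is_outward_normal \<Omega> z n \<longleftrightarrow> norm n = 1 \<and>
     (\<forall>\<epsilon>>0. \<exists>\<delta>>0. \<forall>y\<in>ball z \<delta>.
        ((y - z) \<bullet> n < - \<epsilon> * norm (y - z) \<longrightarrow> y \<in> \<Omega>) \<and>
        ((y - z) \<bullet> n > \<epsilon> * norm (y - z) \<longrightarrow> y \<notin> closure \<Omega>))"

definition outward_normal :: "plane set \<Rightarrow> plane \<Rightarrow> plane" where
  "outward_normal \<Omega> z = (THE n. is_outward_normal \<Omega> z n)"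

definition boundary_split :: "plane set \<Rightarrow> plane set \<Rightarrow> plane set \<Rightarrow> bool" where
  "boundary_split \<Omega> \<Gamma>I \<Gamma>C \<longleftrightarrow>
     frontier \<Omega> = closure \<Gamma>I \<union> closure \<Gamma>C \<and> \<Gamma>I \<inter> \<Gamma>C = {} \<and>
     (\<forall>S\<in>{\<Gamma>I, \<Gamma>C}. openin (top_of_set (frontier \<Omega>)) S \<and>
        emeasure (bd_measure \<Omega>) S > 0 \<and> finite (components S))"


subsection \<open>Sobolev spaces\<close>

text \<open>A function is infinitely differentiable iff it is the head of a family \<open>d\<close>, indexed by
  multi-indices, in which every member is differentiable with partial derivatives the next members;
  \<open>d i j\<close> is then the partial derivative of order \<open>i\<close> in $t$ and \<open>j\<close> in $x$.\<close>

definition smooth :: "(plane \<Rightarrow> real) \<Rightarrow> bool" where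
  "smooth \<phi> \<longleftrightarrow> (\<exists>d::nat \<Rightarrow> nat \<Rightarrow> plane \<Rightarrow> real. d 0 0 = \<phi> \<and>
     (\<forall>i j z. (d i j has_derivative (\<lambda>k. k $ 1 * d (Suc i) j z + k $ 2 * d i (Suc j) z)) (at z)))"

definition test_fun :: "plane set \<Rightarrow> (plane \<Rightarrow> real) \<Rightarrow> bool" where
  "test_fun \<Omega> \<phi> \<longleftrightarrow> smooth \<phi> \<and> compact (closure {z. \<phi> z \<noteq> 0}) \<and> closure {z. \<phi> z \<noteq> 0} \<subseteq> \<Omega>"

definition weak_gradient :: "plane set \<Rightarrow> (plane \<Rightarrow> real) \<Rightarrow> (plane \<Rightarrow> plane) \<Rightarrow> bool" where
  "weak_gradient \<Omega> v w \<longleftrightarrow> w \<in> L2 (lebesgue_on \<Omega>) \<and>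
     (\<forall>\<phi> i. test_fun \<Omega> \<phi> \<longrightarrow>
        (LINT z|lebesgue_on \<Omega>. v z * frechet_derivative \<phi> (at z) (axis i 1)) =
        - (LINT z|lebesgue_on \<Omega>. w z $ i * \<phi> z))"

definition H1 :: "plane set \<Rightarrow> (plane \<Rightarrow> real) set" where
  "H1 \<Omega> = {v \<in> L2 (lebesgue_on \<Omega>). \<exists>w. weak_gradient \<Omega> v w}"

text \<open>Weak gradients are unique almost everywhere, so the choice below is immaterial under
  integrals.\<close>

definition grad :: "plane set \<Rightarrow> (plane \<Rightarrow> real) \<Rightarrow> plane \<Rightarrow> plane" where
  "grad \<Omega> v = (SOME w. weak_gradient \<Omega> v w)"

definition grad_perp :: "plane set \<Rightarrow> (plane \<Rightarrow> real) \<Rightarrow> plane \<Rightarrow> plane" where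
  "grad_perp \<Omega> v z = vector [grad \<Omega> v z $ 2, - (grad \<Omega> v z $ 1)]"

text \<open>The trace operator is the continuous extension to $H^1$ of restriction to the boundary, from
  functions that are smooth up to the boundary.\<close>

definition has_trace :: "plane set \<Rightarrow> (plane \<Rightarrow> real) \<Rightarrow> (plane \<Rightarrow> real) \<Rightarrow> bool" where
  "has_trace \<Omega> v \<tau> \<longleftrightarrow> v \<in> H1 \<Omega> \<and> \<tau> \<in> L2 (bd_measure \<Omega>) \<and>
     (\<exists>\<phi>::nat \<Rightarrow> plane \<Rightarrow> real. (\<forall>k. smooth (\<phi> k)) \<and>
        (\<lambda>k. l2_norm (lebesgue_on \<Omega>) (\<lambda>z. \<phi> k z - v z)) \<longlonglongrightarrow> 0 \<and>
        (\<lambda>k. l2_norm (lebesgue_on \<Omega>) (\<lambda>z. grad \<Omega> (\<phi> k) z - grad \<Omega> v z)) \<longlonglongrightarrow> 0 \<and>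
        (\<lambda>k. l2_norm (bd_measure \<Omega>) (\<lambda>z. \<phi> k z - \<tau> z)) \<longlonglongrightarrow> 0)"

definition bd_trace :: "plane set \<Rightarrow> (plane \<Rightarrow> real) \<Rightarrow> plane \<Rightarrow> real" where
  "bd_trace \<Omega> v = (SOME \<tau>. has_trace \<Omega> v \<tau>)"

definition H10 :: "plane set \<Rightarrow> plane set \<Rightarrow> (plane \<Rightarrow> real) set" where
  "H10 \<Omega> S = {\<phi> \<in> H1 \<Omega>. AE z in bd_measure \<Omega>. z \<in> S \<longrightarrow> bd_trace \<Omega> \<phi> z = 0}"

definition h1_norm :: "plane set \<Rightarrow> (plane \<Rightarrow> real) \<Rightarrow> real" where
  "h1_norm \<Omega> \<phi> = l2_norm (lebesgue_on \<Omega>) (grad \<Omega> \<phi>)"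

text \<open>Norm in the dual of $H^1_{0,S}$, with values in the extended nonnegative reals; an unbounded
  functional has norm \<open>\<infinity>\<close>.\<close>

definition dual_norm :: "plane set \<Rightarrow> plane set \<Rightarrow> ((plane \<Rightarrow> real) \<Rightarrow> real) \<Rightarrow> ennreal" where
  "dual_norm \<Omega> S l = (SUP \<phi>\<in>{\<phi> \<in> H10 \<Omega> S. h1_norm \<Omega> \<phi> \<noteq> 0}. ennreal (\<bar>l \<phi>\<bar> / h1_norm \<Omega> \<phi>))"

definition dual_div :: "plane set \<Rightarrow> (plane \<Rightarrow> plane) \<Rightarrow> (plane \<Rightarrow> real) \<Rightarrow> real" where
  "dual_div \<Omega> v \<phi> = - l2_inner (lebesgue_on \<Omega>) v (grad \<Omega> \<phi>)"

definition helmholtz_decomp ::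
  "plane set \<Rightarrow> plane set \<Rightarrow> plane set \<Rightarrow>
     (plane \<Rightarrow> plane) \<Rightarrow> (plane \<Rightarrow> real) \<Rightarrow> (plane \<Rightarrow> real) \<Rightarrow> bool" where
  "helmholtz_decomp \<Omega> \<Gamma>I \<Gamma>C v q \<psi> \<longleftrightarrow>
     q \<in> H10 \<Omega> \<Gamma>C \<and> \<psi> \<in> H10 \<Omega> \<Gamma>I \<and>
     (AE z in lebesgue_on \<Omega>. v z = grad \<Omega> q z + grad_perp \<Omega> \<psi> z) \<and>
     l2_inner (lebesgue_on \<Omega>) (grad \<Omega> q) (grad_perp \<Omega> \<psi>) = 0 \<and>
     (\<forall>\<phi>\<in>H10 \<Omega> \<Gamma>C. l2_inner (lebesgue_on \<Omega>) (grad \<Omega> q) (grad \<Omega> \<phi>) =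
                      l2_inner (lebesgue_on \<Omega>) v (grad \<Omega> \<phi>)) \<and>
     (\<forall>\<nu>\<in>H10 \<Omega> \<Gamma>I. l2_inner (lebesgue_on \<Omega>) (grad_perp \<Omega> \<psi>) (grad_perp \<Omega> \<nu>) =
                      l2_inner (lebesgue_on \<Omega>) v (grad_perp \<Omega> \<nu>))"


subsection \<open>The balance law and the functionals\<close>

definition locally_lipschitz_flux :: "(real \<Rightarrow> plane) \<Rightarrow> bool" where
  "locally_lipschitz_flux f \<longleftrightarrow>
     (\<forall>J. compact J \<longrightarrow> (\<exists>K>0. \<forall>a\<in>J. \<forall>b\<in>J. \<forall>i. \<bar>f a $ i - f b $ i\<bar> \<le> K * \<bar>a - b\<bar>))"

definition data_functional ::
  "plane set \<Rightarrow> plane set \<Rightarrow> (real \<Rightarrow> plane) \<Rightarrow> (plane \<Rightarrow> real) \<Rightarrow> (plane \<Rightarrow> real) \<Rightarrow>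
     (plane \<Rightarrow> real) \<Rightarrow> real" where
  "data_functional \<Omega> \<Gamma>I f r g \<phi> =
     l2_inner (lebesgue_on \<Omega>) r \<phi>
     - (LINT z:\<Gamma>I|bd_measure \<Omega>. (f (g z) \<bullet> outward_normal \<Omega> z) * bd_trace \<Omega> \<phi> z)"

definition weak_solution ::
  "plane set \<Rightarrow> plane set \<Rightarrow> plane set \<Rightarrow> (real \<Rightarrow> plane) \<Rightarrow> (plane \<Rightarrow> real) \<Rightarrow> (plane \<Rightarrow> real) \<Rightarrow>
     (plane \<Rightarrow> real) \<Rightarrow> bool" where
  "weak_solution \<Omega> \<Gamma>I \<Gamma>C f r g u \<longleftrightarrow> u \<in> Linf (lebesgue_on \<Omega>) \<and>
     (\<forall>\<phi>\<in>H10 \<Omega> \<Gamma>C. - l2_inner (lebesgue_on \<Omega>) (f \<circ> u) (grad \<Omega> \<phi>) = data_functional \<Omega> \<Gamma>I f r g \<phi>)"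

definition F_fun ::
  "plane set \<Rightarrow> (real \<Rightarrow> plane) \<Rightarrow> (plane \<Rightarrow> real) \<Rightarrow> (plane \<Rightarrow> real) \<Rightarrow> (plane \<Rightarrow> real) \<Rightarrow>
     (plane \<Rightarrow> real) \<Rightarrow> real" where
  "F_fun \<Omega> f v p \<mu> q =
     (l2_norm (lebesgue_on \<Omega>) (\<lambda>z. f (v z) - grad \<Omega> p z - grad_perp \<Omega> \<mu> z))\<^sup>2
     + (l2_norm (lebesgue_on \<Omega>) (\<lambda>z. grad \<Omega> p z - grad \<Omega> q z))\<^sup>2"

text \<open>The minimum over \<open>VC\<close> and \<open>VI\<close> is written as an infimum; it is attained when both
  spaces are finite-dimensional.\<close>

definition G_fun ::
  "plane set \<Rightarrow> (real \<Rightarrow> plane) \<Rightarrow> (plane \<Rightarrow> real) set \<Rightarrow> (plane \<Rightarrow> real) set \<Rightarrow>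
     (plane \<Rightarrow> real) \<Rightarrow> (plane \<Rightarrow> real) \<Rightarrow> real" where
  "G_fun \<Omega> f VC VI v q = (INF (p, \<mu>)\<in>VC \<times> VI. F_fun \<Omega> f v p \<mu> q)"

definition flux_span :: "(real \<Rightarrow> plane) \<Rightarrow> (plane \<Rightarrow> real) set \<Rightarrow> (plane \<Rightarrow> plane) set" where
  "flux_span f U = fun_vs.span {f \<circ> v | v. v \<in> U}"

definition inf_sup_const :: "plane set \<Rightarrow> plane set \<Rightarrow> (plane \<Rightarrow> plane) set \<Rightarrow> ennreal" where
  "inf_sup_const \<Omega> \<Gamma>C S =
     (INF s\<in>{s \<in> S. l2_norm (lebesgue_on \<Omega>) s \<noteq> 0}.
        SUP p\<in>{p \<in> H10 \<Omega> \<Gamma>C. h1_norm \<Omega> p \<noteq> 0}.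
          ennreal (\<bar>l2_inner (lebesgue_on \<Omega>) s (grad \<Omega> p)\<bar>
                   / (l2_norm (lebesgue_on \<Omega>) s * l2_norm (lebesgue_on \<Omega>) (grad \<Omega> p))))"


subsection \<open>Mesh parameters\<close>

text \<open>\<open>H\<close> is the set of mesh parameters. Besides accumulating at 0, successive parameters must have
  ratios bounded away from 0: every \<open>t\<close> near 0 has a mesh parameter within a fixed factor below it.
  This covers \<open>H = {0<..h\<^sub>0}\<close> and every decreasing null sequence with \<open>h (Suc k) \<ge> \<rho> * h k\<close>.\<close>

definition mesh_parameters :: "real set \<Rightarrow> bool" where
  "mesh_parameters H \<longleftrightarrow> H \<subseteq> {0<..} \<and>
     (\<exists>\<rho>>0. \<forall>\<^sub>F t in at_right 0. H \<inter> {\<rho> * t..t} \<noteq> {})"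

text \<open>Nestedness is inclusion of spaces of almost-everywhere classes.\<close>

definition nested_spaces :: "plane set \<Rightarrow> real set \<Rightarrow> (real \<Rightarrow> (plane \<Rightarrow> real) set) \<Rightarrow> bool" where
  "nested_spaces \<Omega> H U \<longleftrightarrow>
     (\<forall>h\<in>H. \<forall>h'\<in>H. h' \<le> h \<longrightarrow> (\<forall>v\<in>U h. \<exists>w\<in>U h'. AE z in lebesgue_on \<Omega>. v z = w z))"

end

theory Submission
  imports Defs
begin

text \<open>For mesh parameters \<open>h' \<le> h\<close>, nestedness puts \<open>f (u h) - f (u h')\<close> into the flux span of
  \<open>U h'\<close>. Its pairing with a gradient \<open>\<nabla>p\<close> only sees the difference of the gradient components, of size
  \<open>O(h powr \<kappa>)\<close>, so the inf-sup condition at level \<open>h'\<close> bounds its norm by a multiple of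
  \<open>h powr \<kappa> * h' powr - \<alpha>\<close>. Summing this along a geometric chain of mesh parameters gives
  \<open>O(h powr (\<kappa> - \<alpha>))\<close> uniformly in \<open>h' \<le> h\<close>, and completeness of \<open>L\<^sup>2\<close> supplies the limit.\<close>

section \<open>Norm and inner product of L2 over an arbitrary measure\<close>

lemma L2_measurable: "v \<in> L2 M \<Longrightarrow> v \<in> borel_measurable M"
  and L2_integrable_norm_sq: "v \<in> L2 M \<Longrightarrow> integrable M (\<lambda>z. (norm (v z))\<^sup>2)"
  by (simp_all add: L2_def)

lemma l2_norm_nonneg: "0 \<le> l2_norm M v"
  by (simp add: l2_norm_def)

lemma l2_norm_sq: "(l2_norm M v)\<^sup>2 = (LINT z|M. (norm (v z))\<^sup>2)"
  by (simp add: l2_norm_def)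

lemma l2_norm_cong_AE:
  assumes "v \<in> borel_measurable M" "w \<in> borel_measurable M" "AE z in M. v z = w z"
  shows "l2_norm M v = l2_norm M w"
  unfolding l2_norm_def using assms by (intro arg_cong[where f=sqrt] integral_cong_AE) auto

lemma l2_norm_minus_commute: "l2_norm M (\<lambda>z. v z - w z) = l2_norm M (\<lambda>z. w z - v z)"
  by (simp add: l2_norm_def norm_minus_commute)

lemma L2_uminus: "v \<in> L2 M \<Longrightarrow> (\<lambda>z. - v z) \<in> L2 M"
  by (simp add: L2_def)

lemma integrable_norm_mult_L2:
  assumes "v \<in> L2 M" "w \<in> L2 M"
  shows "integrable M (\<lambda>z. norm (v z) * norm (w z))"
proof (rule Bochner_Integration.integrable_bound)
  show "integrable M (\<lambda>z. (norm (v z))\<^sup>2 + (norm (w z))\<^sup>2)"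
    using assms by (simp add: L2_integrable_norm_sq)
  show "(\<lambda>z. norm (v z) * norm (w z)) \<in> borel_measurable M"
    using assms[THEN L2_measurable] by measurable
  show "AE z in M. norm (norm (v z) * norm (w z)) \<le> norm ((norm (v z))\<^sup>2 + (norm (w z))\<^sup>2)"
  proof (rule AE_I2)
    fix z
    have "2 * (norm (v z) * norm (w z)) \<le> (norm (v z))\<^sup>2 + (norm (w z))\<^sup>2"
      using sum_squares_bound[of "norm (v z)" "norm (w z)"] by simp
    moreover have "0 \<le> norm (v z) * norm (w z)" by simp
    ultimately show "norm (norm (v z) * norm (w z)) \<le> norm ((norm (v z))\<^sup>2 + (norm (w z))\<^sup>2)"
      unfolding real_norm_def by linarith
  qed
qed

lemma integrable_inner_L2:
  assumes "v \<in> L2 M" "w \<in> L2 M"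
  shows "integrable M (\<lambda>z. v z \<bullet> w z)"
proof (rule Bochner_Integration.integrable_bound[OF integrable_norm_mult_L2[OF assms]])
  show "(\<lambda>z. v z \<bullet> w z) \<in> borel_measurable M"
    using assms[THEN L2_measurable] by measurable
qed (simp add: abs_mult Cauchy_Schwarz_ineq2)

lemma L2_add:
  assumes "v \<in> L2 M" "w \<in> L2 M"
  shows "(\<lambda>z. v z + w z) \<in> L2 M"
proof -
  have "integrable M (\<lambda>z. (norm (v z))\<^sup>2 + 2 * (v z \<bullet> w z) + (norm (w z))\<^sup>2)"
    using assms by (simp add: L2_integrable_norm_sq integrable_inner_L2)
  moreover have "(norm (v z + w z))\<^sup>2 = (norm (v z))\<^sup>2 + 2 * (v z \<bullet> w z) + (norm (w z))\<^sup>2" for z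
    by (simp add: power2_norm_eq_inner inner_add inner_commute)
  ultimately show ?thesis
    using assms[THEN L2_measurable] by (simp add: L2_def)
qed

lemma L2_diff: "v \<in> L2 M \<Longrightarrow> w \<in> L2 M \<Longrightarrow> (\<lambda>z. v z - w z) \<in> L2 M"
  using L2_add[OF _ L2_uminus, of v M w] by simp

lemma l2_norm_eq_0_imp_AE:
  assumes "v \<in> L2 M" "l2_norm M v = 0"
  shows "AE z in M. v z = 0"
proof -
  have "(LINT z|M. (norm (v z))\<^sup>2) = 0"
    using assms(2) by (simp flip: l2_norm_sq)
  then have "AE z in M. (norm (v z))\<^sup>2 = 0"
    using integral_nonneg_eq_0_iff_AE[OF L2_integrable_norm_sq[OF assms(1)]] by simp
  then show ?thesis by simp
qed

text \<open>Cauchy-Schwarz for the pointwise norms, by Young's inequality with weights that balance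
  the two norms. The weights are quotients of the norms, so a vanishing norm is treated first; there
  the integrand is zero almost everywhere.\<close>

lemma integral_norm_mult_le:
  assumes "v \<in> L2 M" "w \<in> L2 M"
  shows "(LINT z|M. norm (v z) * norm (w z)) \<le> l2_norm M v * l2_norm M w"
proof (cases "l2_norm M v = 0 \<or> l2_norm M w = 0")
  case True
  then have "(AE z in M. v z = 0) \<or> (AE z in M. w z = 0)"
    using l2_norm_eq_0_imp_AE[OF assms(1)] l2_norm_eq_0_imp_AE[OF assms(2)] by blast
  then have "AE z in M. norm (v z) * norm (w z) = 0"
    by (elim disjE) (auto elim!: eventually_mono)
  then have "(LINT z|M. norm (v z) * norm (w z)) = 0"
    by (rule integral_eq_zero_AE)
  then show ?thesis by (simp add: l2_norm_nonneg)
next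
  case False
  define a b where ab: "a = l2_norm M v" "b = l2_norm M w"
  then have pos: "a > 0" "b > 0"
    using False l2_norm_nonneg[of M v] l2_norm_nonneg[of M w] by linarith+
  \<comment> \<open>Expansion of a square. Under the weights \<open>b / a\<close> and
    \<open>a / b\<close> both integrals on the right become \<open>a * b\<close>.\<close>
  have "norm (v z) * norm (w z) \<le> (b / a * (norm (v z))\<^sup>2 + a / b * (norm (w z))\<^sup>2) / 2" for z
  proof -
    have "0 \<le> (b * norm (v z) - a * norm (w z))\<^sup>2 / (a * b)"
      using pos by simp
    also have "\<dots> = b / a * (norm (v z))\<^sup>2 + a / b * (norm (w z))\<^sup>2 - 2 * (norm (v z) * norm (w z))"
      using pos by (simp add: field_simps power2_eq_square)
    finally show ?thesis by simp
  qed
  then have "(LINT z|M. norm (v z) * norm (w z))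
      \<le> (LINT z|M. (b / a * (norm (v z))\<^sup>2 + a / b * (norm (w z))\<^sup>2) / 2)"
    using assms by (intro integral_mono)
      (auto simp: integrable_norm_mult_L2 L2_integrable_norm_sq)
  also have "\<dots> = (b / a * a\<^sup>2 + a / b * b\<^sup>2) / 2"
    using assms by (simp add: ab L2_integrable_norm_sq l2_norm_sq)
  also have "\<dots> = a * b"
    using pos by (simp add: power2_eq_square)
  finally show ?thesis by (simp add: ab)
qed

lemma l2_Cauchy_Schwarz:
  assumes "v \<in> L2 M" "w \<in> L2 M"
  shows "\<bar>l2_inner M v w\<bar> \<le> l2_norm M v * l2_norm M w"
proof -
  have "\<bar>l2_inner M v w\<bar> \<le> (LINT z|M. norm (v z \<bullet> w z))"
    unfolding l2_inner_def using integral_norm_bound[of M "\<lambda>z. v z \<bullet> w z"] by simp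
  also have "\<dots> \<le> (LINT z|M. norm (v z) * norm (w z))"
    using assms by (intro integral_mono)
      (auto simp: integrable_norm_mult_L2 integrable_inner_L2 Cauchy_Schwarz_ineq2)
  also note integral_norm_mult_le[OF assms]
  finally show ?thesis .
qed

lemma l2_norm_triangle:
  assumes "v \<in> L2 M" "w \<in> L2 M"
  shows "l2_norm M (\<lambda>z. v z + w z) \<le> l2_norm M v + l2_norm M w"
proof (rule power2_le_imp_le)
  have "(l2_norm M (\<lambda>z. v z + w z))\<^sup>2
      = (LINT z|M. (norm (v z))\<^sup>2 + 2 * (v z \<bullet> w z) + (norm (w z))\<^sup>2)"
    unfolding l2_norm_sq by (simp add: power2_norm_eq_inner inner_add inner_commute algebra_simps)
  also have "\<dots> = (l2_norm M v)\<^sup>2 + 2 * l2_inner M v w + (l2_norm M w)\<^sup>2"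
    using assms by (simp add: l2_norm_sq l2_inner_def L2_integrable_norm_sq integrable_inner_L2)
  also have "\<dots> \<le> (l2_norm M v + l2_norm M w)\<^sup>2"
    using l2_Cauchy_Schwarz[OF assms] by (simp add: power2_sum)
  finally show "(l2_norm M (\<lambda>z. v z + w z))\<^sup>2 \<le> (l2_norm M v + l2_norm M w)\<^sup>2" .
qed (simp add: l2_norm_nonneg)

lemma l2_norm_diff_triangle:
  assumes "v \<in> L2 M" "w \<in> L2 M" "y \<in> L2 M"
  shows "l2_norm M (\<lambda>z. v z - y z) \<le> l2_norm M (\<lambda>z. v z - w z) + l2_norm M (\<lambda>z. w z - y z)"
  using l2_norm_triangle[of "\<lambda>z. v z - w z" M "\<lambda>z. w z - y z"] assms by (simp add: L2_diff)

section \<open>Membership in L2, and its completeness over finite measures\<close>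

lemma L2_bounded:
  assumes "finite_measure M" "v \<in> borel_measurable M" "AE z in M. norm (v z) \<le> K"
  shows "v \<in> L2 M"
proof -
  interpret finite_measure M by fact
  have "integrable M (\<lambda>z. (norm (v z))\<^sup>2)"
  proof (rule integrable_const_bound)
    show "AE z in M. norm ((norm (v z))\<^sup>2) \<le> K\<^sup>2"
      using assms(3) by (rule AE_mp) (auto intro!: AE_I2 power_mono)
    show "(\<lambda>z. (norm (v z))\<^sup>2) \<in> borel_measurable M" using assms(2) by measurable
  qed
  with assms(2) show ?thesis by (simp add: L2_def)
qed

text \<open>A nonintegrable function has Bochner integral 0, so a bound on \<open>l2_norm\<close>
  alone says nothing about membership in \<open>L2\<close>. The bound is therefore posed for the
  nonnegative integral, the form in which Fatou's lemma delivers it.\<close>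

lemma L2_I_nn_integral:
  assumes "v \<in> borel_measurable M" "(\<integral>\<^sup>+z. ennreal ((norm (v z))\<^sup>2) \<partial>M) \<le> ennreal (b\<^sup>2)" "0 \<le> b"
  shows "v \<in> L2 M" "l2_norm M v \<le> b"
proof -
  have int: "integrable M (\<lambda>z. (norm (v z))\<^sup>2)"
  proof (rule integrableI_bounded)
    show "(\<lambda>z. (norm (v z))\<^sup>2) \<in> borel_measurable M" using assms(1) by measurable
    show "(\<integral>\<^sup>+z. ennreal (norm ((norm (v z))\<^sup>2)) \<partial>M) < \<infinity>"
      using assms(2) by (simp add: le_less_trans[OF _ ennreal_less_top])
  qed
  then show "v \<in> L2 M" using assms(1) by (simp add: L2_def)
  have "ennreal ((l2_norm M v)\<^sup>2) \<le> ennreal (b\<^sup>2)"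
    using assms(2) nn_integral_eq_integral[OF int] by (simp add: l2_norm_sq)
  then have "(l2_norm M v)\<^sup>2 \<le> b\<^sup>2"
    by (simp add: ennreal_le_iff)
  then show "l2_norm M v \<le> b"
    using assms(3) by (rule power2_le_imp_le)
qed

text \<open>Cauchy-Schwarz against the constant function 1, which lies in \<open>L2\<close> because
  the measure is finite. It turns L2 bounds on increments into L1 bounds.\<close>

lemma integral_norm_le_l2_norm:
  assumes "finite_measure M" "v \<in> L2 M"
  shows "integrable M (\<lambda>z. norm (v z))"
    "(LINT z|M. norm (v z)) \<le> sqrt (measure M (space M)) * l2_norm M v"
proof -
  interpret finite_measure M by fact
  have one: "(\<lambda>z. 1 :: real) \<in> L2 M"
    by (rule L2_bounded[OF assms(1)]) auto
  show "integrable M (\<lambda>z. norm (v z))"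
    using integrable_norm_mult_L2[OF one assms(2)] by simp
  show "(LINT z|M. norm (v z)) \<le> sqrt (measure M (space M)) * l2_norm M v"
    using integral_norm_mult_le[OF one assms(2)] by (simp add: l2_norm_def[of M "\<lambda>z. 1 :: real"])
qed

text \<open>Telescoping with the triangle inequality. The indices are written \<open>i + k\<close>
  so that the right-hand side is a partial sum of the tail starting at \<open>k\<close>.\<close>

lemma l2_norm_diff_le_sum:
  assumes "\<And>k. v k \<in> L2 M"
  shows "l2_norm M (\<lambda>z. v k z - v (k + n) z) \<le> (\<Sum>i<n. l2_norm M (\<lambda>z. v (i + k) z - v (Suc (i + k)) z))"
proof (induction n)
  case 0
  then show ?case by (simp add: l2_norm_def)
next
  case (Suc n)
  then show ?case
    using l2_norm_diff_triangle[OF assms[of k] assms[of "k + n"] assms[of "Suc (k + n)"]]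
    by (simp add: add.commute)
qed

text \<open>On a finite measure space the series of increments converges in \<open>L\<^sup>1\<close>, hence absolutely almost
  everywhere; Fatou's lemma then bounds the distance to the pointwise limit.\<close>

lemma L2_convergent_if_summable:
  fixes v :: "nat \<Rightarrow> plane \<Rightarrow> 'b::euclidean_space"
  assumes M: "finite_measure M" and v: "\<And>k. v k \<in> L2 M"
    and summable: "summable (\<lambda>k. l2_norm M (\<lambda>z. v k z - v (Suc k) z))"
  shows "\<exists>w\<in>L2 M. (\<lambda>k. l2_norm M (\<lambda>z. v k z - w z)) \<longlonglongrightarrow> 0"
proof -
  define a where "a = (\<lambda>k. l2_norm M (\<lambda>z. v k z - v (Suc k) z))"
  \<comment> \<open>The tail sums of the increments bound the distance from \<open>v k\<close> to
    every later member, and they tend to 0.\<close>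
  define T where "T = (\<lambda>k. \<Sum>i. a (i + k))"
  \<comment> \<open>Where the sequence diverges, \<open>lim\<close> has an unspecified value; this
    happens only on a null set, and \<open>w\<close> is measurable in any case.\<close>
  define w where "w = (\<lambda>z. lim (\<lambda>m. v m z))"
  have a0: "0 \<le> a k" for k by (simp add: a_def l2_norm_nonneg)
  have sm: "summable a" using summable by (simp add: a_def)
  have meas[measurable]: "v k \<in> borel_measurable M" for k using v by (rule L2_measurable)
  have w_meas[measurable]: "w \<in> borel_measurable M"
    unfolding w_def by (rule borel_measurable_lim_metric) (rule meas)
  define S where "S = sqrt (measure M (space M))"
  have step: "(\<integral>\<^sup>+z. ennreal (norm (v k z - v (Suc k) z)) \<partial>M) \<le> ennreal (S * a k)" for k
  proof -
    note L1 = integral_norm_le_l2_norm[OF M L2_diff[OF v[of k] v[of "Suc k"]]]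
    show ?thesis
      using L1(2) by (subst nn_integral_eq_integral[OF L1(1)]) (auto simp: S_def a_def intro: ennreal_leI)
  qed
  have "(\<integral>\<^sup>+z. (\<Sum>k. ennreal (norm (v k z - v (Suc k) z))) \<partial>M)
      = (\<Sum>k. \<integral>\<^sup>+z. ennreal (norm (v k z - v (Suc k) z)) \<partial>M)"
    by (rule nn_integral_suminf) measurable
  also have "\<dots> \<le> (\<Sum>k. ennreal (S * a k))"
    by (intro suminf_le step) auto
  also have "\<dots> = ennreal (\<Sum>k. S * a k)"
    using sm a0 by (intro suminf_ennreal2) (auto simp: S_def intro: summable_mult)
  finally have "(\<integral>\<^sup>+z. (\<Sum>k. ennreal (norm (v k z - v (Suc k) z))) \<partial>M) \<noteq> \<infinity>"
    by (auto simp: top_unique)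
  \<comment> \<open>A nonnegative function with finite integral is finite almost everywhere. At such
    points the increments are absolutely summable, and their partial sums telescope.\<close>
  then have "AE z in M. (\<Sum>k. ennreal (norm (v k z - v (Suc k) z))) \<noteq> \<infinity>"
    by (intro nn_integral_PInf_AE) measurable
  then have lim: "AE z in M. (\<lambda>m. v m z) \<longlonglongrightarrow> w z"
  proof (rule AE_mp, intro AE_I2 impI)
    fix z assume "(\<Sum>k. ennreal (norm (v k z - v (Suc k) z))) \<noteq> \<infinity>"
    then have "summable (\<lambda>k. norm (v k z - v (Suc k) z))"
      by (intro summable_suminf_not_top) auto
    then have "summable (\<lambda>k. v k z - v (Suc k) z)"
      by (rule summable_norm_cancel)
    then obtain s where "(\<lambda>n. \<Sum>k<n. v k z - v (Suc k) z) \<longlonglongrightarrow> s"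
      by (auto simp: summable_def sums_def)
    then have "(\<lambda>n. v 0 z - v n z) \<longlonglongrightarrow> s"
      by (simp only: sum_lessThan_telescope'[of "\<lambda>k. v k z"])
    then have "(\<lambda>n. v 0 z - (v 0 z - v n z)) \<longlonglongrightarrow> v 0 z - s"
      by (intro tendsto_diff tendsto_const)
    then show "(\<lambda>m. v m z) \<longlonglongrightarrow> w z"
      unfolding w_def by (simp add: limI)
  qed
  have T0: "0 \<le> T k" for k
    unfolding T_def using a0 sm by (intro suminf_nonneg) (auto simp: summable_iff_shift)
  have dist: "l2_norm M (\<lambda>z. v k z - v (k + n) z) \<le> T k" for k n
  proof -
    have "(\<Sum>i<n. a (i + k)) \<le> T k"
      unfolding T_def using a0 sm by (intro sum_le_suminf) (auto simp: summable_iff_shift)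
    then show ?thesis
      using l2_norm_diff_le_sum[of v M k n] v by (simp add: a_def)
  qed
  \<comment> \<open>With \<open>k\<close> fixed, the integrand is the pointwise limit in
    \<open>n\<close> of the squared distances to \<open>v (k + n)\<close>, whose integrals are
    bounded by the square of \<open>T k\<close> for every \<open>n\<close>.\<close>
  have Fatou: "(\<integral>\<^sup>+z. ennreal ((norm (v k z - w z))\<^sup>2) \<partial>M) \<le> ennreal ((T k)\<^sup>2)" for k
  proof -
    have "(\<integral>\<^sup>+z. ennreal ((norm (v k z - w z))\<^sup>2) \<partial>M)
        = (\<integral>\<^sup>+z. liminf (\<lambda>n. ennreal ((norm (v k z - v (k + n) z))\<^sup>2)) \<partial>M)"
    proof (rule nn_integral_cong_AE, rule AE_mp[OF lim], intro AE_I2 impI)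
      fix z assume "(\<lambda>m. v m z) \<longlonglongrightarrow> w z"
      then have "(\<lambda>n. v (k + n) z) \<longlonglongrightarrow> w z"
        using LIMSEQ_ignore_initial_segment[of "\<lambda>m. v m z" "w z" k] by (simp add: add.commute)
      then have "(\<lambda>n. ennreal ((norm (v k z - v (k + n) z))\<^sup>2)) \<longlonglongrightarrow> ennreal ((norm (v k z - w z))\<^sup>2)"
        by (intro tendsto_intros tendsto_ennrealI)
      from lim_imp_Liminf[OF _ this] show "ennreal ((norm (v k z - w z))\<^sup>2) = liminf (\<lambda>n. ennreal ((norm (v k z - v (k + n) z))\<^sup>2))"
        by simp
    qed
    also have "\<dots> \<le> liminf (\<lambda>n. \<integral>\<^sup>+z. ennreal ((norm (v k z - v (k + n) z))\<^sup>2) \<partial>M)"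
      by (rule nn_integral_liminf) measurable
    also have "\<dots> \<le> ennreal ((T k)\<^sup>2)"
    proof (rule Liminf_le[OF sequentially_bot eventuallyI])
      fix n
      have "(\<integral>\<^sup>+z. ennreal ((norm (v k z - v (k + n) z))\<^sup>2) \<partial>M)
          = ennreal ((l2_norm M (\<lambda>z. v k z - v (k + n) z))\<^sup>2)"
        using L2_integrable_norm_sq[OF L2_diff[OF v v]]
        by (simp add: l2_norm_sq nn_integral_eq_integral)
      also have "\<dots> \<le> ennreal ((T k)\<^sup>2)"
        using dist by (intro ennreal_leI power_mono) (auto simp: l2_norm_nonneg)
      finally show "(\<integral>\<^sup>+z. ennreal ((norm (v k z - v (k + n) z))\<^sup>2) \<partial>M) \<le> ennreal ((T k)\<^sup>2)" .
    qed
    finally show ?thesis .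
  qed
  note diff = L2_I_nn_integral[OF _ Fatou T0]
  \<comment> \<open>The Fatou bound puts \<open>v 0 - w\<close> into \<open>L2\<close>; subtracting
    it from \<open>v 0\<close> recovers \<open>w\<close>.\<close>
  have "(\<lambda>z. v 0 z - (v 0 z - w z)) \<in> L2 M"
    by (intro L2_diff v diff(1)) measurable
  then have "w \<in> L2 M" by simp
  moreover have "(\<lambda>k. l2_norm M (\<lambda>z. v k z - w z)) \<longlonglongrightarrow> 0"
  proof (rule tendsto_sandwich[OF _ _ tendsto_const])
    show "T \<longlonglongrightarrow> 0"
      using suminf_exist_split2[OF sm] by (simp add: T_def)
    show "\<forall>\<^sub>F k in sequentially. l2_norm M (\<lambda>z. v k z - w z) \<le> T k"
      by (intro eventuallyI diff(2)) measurable
  qed (simp add: l2_norm_nonneg)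
  ultimately show ?thesis by blast
qed


section \<open>Gradients, fluxes, Helmholtz components and the inf-sup condition\<close>

lemma l2_inner_diff_left:
  assumes "v \<in> L2 M" "v' \<in> L2 M" "w \<in> L2 M"
  shows "l2_inner M (\<lambda>z. v z - v' z) w = l2_inner M v w - l2_inner M v' w"
  using assms by (simp add: l2_inner_def inner_diff_left integrable_inner_L2)

lemma grad_L2:
  assumes "v \<in> H1 \<Omega>"
  shows "grad \<Omega> v \<in> L2 (lebesgue_on \<Omega>)"
proof -
  have "\<exists>w. weak_gradient \<Omega> v w" using assms by (simp add: H1_def)
  then have "weak_gradient \<Omega> v (grad \<Omega> v)" unfolding grad_def by (rule someI_ex)
  then show ?thesis by (simp add: weak_gradient_def)
qed

lemma H10_subset_H1: "H10 \<Omega> S \<subseteq> H1 \<Omega>"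
  by (auto simp: H10_def)

text \<open>A Lipschitz constant on the closed unit ball around a point gives continuity at its
  centre. Continuity supplies both measurability and local boundedness of the flux.\<close>

lemma locally_lipschitz_flux_continuous:
  assumes "locally_lipschitz_flux f"
  shows "continuous_on UNIV f"
proof (rule continuous_at_imp_continuous_on, rule ballI)
  fix x :: real
  obtain K where K: "K > 0" "\<And>a b i. a \<in> cball x 1 \<Longrightarrow> b \<in> cball x 1 \<Longrightarrow> \<bar>f a $ i - f b $ i\<bar> \<le> K * \<bar>a - b\<bar>"
    using assms unfolding locally_lipschitz_flux_def by (meson compact_cball)
  have "(2 * K)-lipschitz_on (cball x 1) f"
  proof (rule lipschitz_onI)
    fix a b assume ab: "a \<in> cball x 1" "b \<in> cball x 1"
    \<comment> \<open>The Euclidean norm is at most the sum of the two component moduli, hence the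
      factor 2.\<close>
    have "dist (f a) (f b) \<le> (\<Sum>i\<in>UNIV. \<bar>f a $ i - f b $ i\<bar>)"
      using norm_le_l1_cart[of "f a - f b"] by (simp add: dist_norm)
    also have "\<dots> \<le> (\<Sum>i\<in>(UNIV::2 set). K * \<bar>a - b\<bar>)"
      using K(2)[OF ab] by (rule sum_mono)
    finally show "dist (f a) (f b) \<le> 2 * K * dist a b"
      by (simp add: dist_real_def)
  qed (use K in simp)
  then have "continuous_on (cball x 1) f" by (rule lipschitz_on_continuous_on)
  then show "isCont f x" by (rule continuous_on_interior) simp
qed

text \<open>An essentially bounded function takes almost all its values in a compact interval, where
  a continuous flux is bounded; over a finite measure, boundedness suffices.\<close>

lemma flux_comp_L2:
  fixes f :: "real \<Rightarrow> 'b::euclidean_space"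
  assumes M: "finite_measure M" and f: "continuous_on UNIV f" and v: "v \<in> Linf M"
  shows "(\<lambda>z. f (v z)) \<in> L2 M"
proof -
  obtain K where K: "AE z in M. \<bar>v z\<bar> \<le> K" and [measurable]: "v \<in> borel_measurable M"
    using v by (auto simp: Linf_def)
  have "compact (f ` {-K..K})"
    using f by (intro compact_continuous_image) (auto intro: continuous_on_subset)
  then obtain B where B: "\<And>a. a \<in> {-K..K} \<Longrightarrow> norm (f a) \<le> B"
    by (meson bounded_iff compact_imp_bounded imageI)
  show ?thesis
  proof (rule L2_bounded[OF M])
    show "(\<lambda>z. f (v z)) \<in> borel_measurable M"
      using measurable_compose[OF \<open>v \<in> borel_measurable M\<close> borel_measurable_continuous_onI[OF f]] .
    show "AE z in M. norm (f (v z)) \<le> B"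
      using K by (rule AE_mp) (auto intro!: AE_I2 B simp: abs_le_iff)
  qed
qed

text \<open>The variational identity for the gradient component lets \<open>v\<close> be replaced by
  \<open>grad \<Omega> q\<close> when it is paired with gradients from
  \<open>H10 \<Omega> \<Gamma>C\<close>. The pairing thus sees only the difference of the gradient
  components, and Cauchy-Schwarz applies.\<close>

lemma helmholtz_decomp_diff_inner_le:
  assumes "helmholtz_decomp \<Omega> \<Gamma>I \<Gamma>C v q \<psi>" "helmholtz_decomp \<Omega> \<Gamma>I \<Gamma>C v' q' \<psi>'"
    and v: "v \<in> L2 (lebesgue_on \<Omega>)" "v' \<in> L2 (lebesgue_on \<Omega>)" and p: "p \<in> H10 \<Omega> \<Gamma>C"
  shows "\<bar>l2_inner (lebesgue_on \<Omega>) (\<lambda>z. v z - v' z) (grad \<Omega> p)\<bar>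
      \<le> l2_norm (lebesgue_on \<Omega>) (\<lambda>z. grad \<Omega> q z - grad \<Omega> q' z) * h1_norm \<Omega> p"
proof -
  have L2: "grad \<Omega> q \<in> L2 (lebesgue_on \<Omega>)" "grad \<Omega> q' \<in> L2 (lebesgue_on \<Omega>)"
    "grad \<Omega> p \<in> L2 (lebesgue_on \<Omega>)"
    using assms H10_subset_H1 by (auto simp: helmholtz_decomp_def intro!: grad_L2)
  have "l2_inner (lebesgue_on \<Omega>) (\<lambda>z. v z - v' z) (grad \<Omega> p)
      = l2_inner (lebesgue_on \<Omega>) (\<lambda>z. grad \<Omega> q z - grad \<Omega> q' z) (grad \<Omega> p)"
    using assms L2 by (simp add: l2_inner_diff_left helmholtz_decomp_def)
  then show ?thesis
    using l2_Cauchy_Schwarz[OF L2_diff[OF L2(1,2)] L2(3)] by (simp add: h1_norm_def)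
qed

text \<open>The infimum is at most its value at \<open>s\<close>, where every quotient in the
  supremum is bounded by \<open>X\<close> over the norm of \<open>s\<close>. Fields of norm zero are
  excluded from the infimum, but for them the claim is just \<open>0 \<le> X\<close>.\<close>

lemma inf_sup_const_bound:
  assumes b: "ennreal b \<le> inf_sup_const \<Omega> \<Gamma>C S" and "s \<in> S" "0 \<le> X"
    and X: "\<And>p. p \<in> H10 \<Omega> \<Gamma>C \<Longrightarrow> \<bar>l2_inner (lebesgue_on \<Omega>) s (grad \<Omega> p)\<bar> \<le> X * h1_norm \<Omega> p"
  shows "b * l2_norm (lebesgue_on \<Omega>) s \<le> X"
proof (cases "l2_norm (lebesgue_on \<Omega>) s = 0")
  case True
  then show ?thesis using \<open>0 \<le> X\<close> by simp
next
  case False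
  let ?n = "l2_norm (lebesgue_on \<Omega>) s"
  have n: "?n > 0" using False l2_norm_nonneg[of "lebesgue_on \<Omega>" s] by linarith
  have "inf_sup_const \<Omega> \<Gamma>C S \<le> ennreal (X / ?n)"
    unfolding inf_sup_const_def
  proof (rule INF_lower2)
    show "s \<in> {s \<in> S. l2_norm (lebesgue_on \<Omega>) s \<noteq> 0}" using \<open>s \<in> S\<close> False by simp
    show "(SUP p\<in>{p \<in> H10 \<Omega> \<Gamma>C. h1_norm \<Omega> p \<noteq> 0}.
          ennreal (\<bar>l2_inner (lebesgue_on \<Omega>) s (grad \<Omega> p)\<bar>
                   / (?n * l2_norm (lebesgue_on \<Omega>) (grad \<Omega> p)))) \<le> ennreal (X / ?n)"
    proof (rule SUP_least, rule ennreal_leI)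
      fix p assume p: "p \<in> {p \<in> H10 \<Omega> \<Gamma>C. h1_norm \<Omega> p \<noteq> 0}"
      then have "l2_norm (lebesgue_on \<Omega>) (grad \<Omega> p) > 0"
        using l2_norm_nonneg[of "lebesgue_on \<Omega>" "grad \<Omega> p"] by (simp add: h1_norm_def)
      then show "\<bar>l2_inner (lebesgue_on \<Omega>) s (grad \<Omega> p)\<bar>
          / (?n * l2_norm (lebesgue_on \<Omega>) (grad \<Omega> p)) \<le> X / ?n"
        using X[of p] p n by (simp add: h1_norm_def pos_divide_le_eq)
    qed
  qed
  with b have "ennreal b \<le> ennreal (X / ?n)" by (rule order_trans)
  then have "b \<le> X / ?n" using \<open>0 \<le> X\<close> n by (simp add: ennreal_le_iff)
  then show ?thesis using n by (simp add: pos_le_divide_eq)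
qed

section \<open>Mesh parameters: chaining the estimate and passing to the limit\<close>

lemma mesh_parameters_small:
  assumes "mesh_parameters H" "\<epsilon> > 0"
  shows "\<exists>h\<in>H. h < \<epsilon>"
proof -
  obtain \<rho> where "\<forall>\<^sub>F t in at_right 0. H \<inter> {\<rho> * t..t} \<noteq> {}"
    using assms by (auto simp: mesh_parameters_def)
  then obtain b where "b > 0" "\<And>t. 0 < t \<Longrightarrow> t < b \<Longrightarrow> H \<inter> {\<rho> * t..t} \<noteq> {}"
    by (auto simp: eventually_at_right_field)
  moreover define t where "t = min b \<epsilon> / 2"
  then have "0 < t" "t < b" "t < \<epsilon>" using \<open>b > 0\<close> assms(2) by auto
  ultimately have "H \<inter> {\<rho> * t..t} \<noteq> {}" by blast
  with \<open>t < \<epsilon>\<close> show ?thesis by force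
qed

text \<open>The hypothesis loses a factor \<open>(h / h') powr \<alpha>\<close>. It is harmless between consecutive members of a
  chain from \<open>h\<close> down to \<open>h'\<close> in which each step divides the parameter by at least 2 and at most
  \<open>2 / \<rho>\<close>, and the resulting bounds form a geometric series.\<close>

lemma mesh_parameters_chain:
  fixes d :: "real \<Rightarrow> real \<Rightarrow> real"
  assumes mesh: "mesh_parameters H" and \<alpha>: "0 < \<alpha>" "\<alpha> < \<kappa>" and D: "0 \<le> D"
    and tri: "\<And>a b c. a \<in> H \<Longrightarrow> b \<in> H \<Longrightarrow> c \<in> H \<Longrightarrow> d a c \<le> d a b + d b c"
    and bd: "\<And>h h'. h \<in> H \<Longrightarrow> h' \<in> H \<Longrightarrow> h' \<le> h \<Longrightarrow> d h h' \<le> D * h powr \<kappa> * h' powr - \<alpha>"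
  shows "\<exists>E h0. 0 \<le> E \<and> 0 < h0 \<and>
    (\<forall>h\<in>H. \<forall>h'\<in>H. h' \<le> h \<longrightarrow> h < h0 \<longrightarrow> d h h' \<le> E * h powr (\<kappa> - \<alpha>))"
proof -
  have pos: "h > 0" if "h \<in> H" for h
    using mesh that by (auto simp: mesh_parameters_def)
  obtain \<rho> h0 where \<rho>: "\<rho> > 0" and h0: "h0 > 0"
    and step: "\<And>t. 0 < t \<Longrightarrow> t < h0 \<Longrightarrow> H \<inter> {\<rho> * t..t} \<noteq> {}"
    using mesh by (auto simp: mesh_parameters_def eventually_at_right_field)
  \<comment> \<open>For small \<open>t\<close> the interval from \<open>\<rho> * t\<close> to
    \<open>t\<close> contains a mesh parameter, so it is nonempty.\<close>
  have "\<rho> \<le> 1"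
    using step[of "h0 / 2"] h0 by (auto simp: field_simps)
  \<comment> \<open>\<open>\<sigma>\<close> bounds the ratio of one chain step from below: a
    parameter found between \<open>\<rho> * (h / 2)\<close> and \<open>h / 2\<close> is at least
    \<open>\<sigma> * h\<close>.\<close>
  define \<beta> \<sigma> D' where "\<beta> = \<kappa> - \<alpha>" and "\<sigma> = \<rho> / 2" and "D' = D * \<sigma> powr - \<alpha>"
  define \<theta> where "\<theta> = (1 / 2) powr \<beta>"
  \<comment> \<open>The sum of the geometric series with terms \<open>D' * \<theta> ^ k\<close>. It
    solves \<open>D' + \<theta> * E = E\<close>, so the induction step below reproduces the
    constant.\<close>
  define E where "E = D' / (1 - \<theta>)"
  have \<sigma>: "0 < \<sigma>" "\<sigma> \<le> 1" using \<rho> \<open>\<rho> \<le> 1\<close> by (auto simp: \<sigma>_def)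
  have \<theta>: "0 < \<theta>" "\<theta> < 1"
    using \<alpha> powr_less_mono2[of \<beta> "1 / 2" 1] by (auto simp: \<theta>_def \<beta>_def)
  have D': "0 \<le> D'" using D by (simp add: D'_def)
  have E: "D' + \<theta> * E = E" "D' \<le> E" "0 \<le> E"
    using \<theta> D' by (auto simp: E_def field_simps)
  \<comment> \<open>For comparable parameters the negative power of \<open>h'\<close> costs only the
    constant factor \<open>\<sigma> powr - \<alpha>\<close>.\<close>
  have direct: "d h h' \<le> D' * h powr \<beta>" if h: "h \<in> H" "h' \<in> H" "h' \<le> h" "\<sigma> * h \<le> h'" for h h'
  proof -
    have "d h h' \<le> D * h powr \<kappa> * h' powr - \<alpha>" using h by (intro bd)
    also have "\<dots> \<le> D * h powr \<kappa> * (\<sigma> * h) powr - \<alpha>"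
      using h \<sigma> pos[OF h(1)] D \<alpha> by (intro mult_left_mono powr_mono2') auto
    also have "\<dots> = D' * h powr \<beta>"
      using \<sigma> pos[OF h(1)] by (simp add: D'_def \<beta>_def powr_mult powr_diff powr_minus field_simps)
    finally show ?thesis .
  qed
  \<comment> \<open>\<open>n\<close> bounds the number of halvings from \<open>h\<close> to
    \<open>h'\<close>; the end \<open>h'\<close> stays fixed while the start of the chain varies in
    the induction.\<close>
  have "d h h' \<le> E * h powr \<beta>"
    if "h \<in> H" "h' \<in> H" "h' \<le> h" "h < h0" "h \<le> 2 ^ n * h'" for h h' n
    using that
  proof (induction n arbitrary: h)
    case 0
    then have "h' = h" by simp
    \<comment> \<open>\<open>d\<close> need not vanish on the diagonal, so the direct bound is used
      here too.\<close>
    then have "d h h' \<le> D' * h powr \<beta>"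
      using 0 \<sigma> pos[of h] by (intro direct) auto
    also have "\<dots> \<le> E * h powr \<beta>" using E by (intro mult_right_mono) auto
    finally show ?case .
  next
    case (Suc n)
    show ?case
    proof (cases "\<sigma> * h \<le> h'")
      case True
      then have "d h h' \<le> D' * h powr \<beta>" using Suc.prems by (intro direct)
      also have "\<dots> \<le> E * h powr \<beta>" using E by (intro mult_right_mono) auto
      finally show ?thesis .
    next
      case False
      have h: "h > 0" using Suc.prems pos by blast
      \<comment> \<open>Since \<open>h' < \<sigma> * h\<close>, the parameter \<open>h1\<close> lies
        between \<open>h'\<close> and \<open>h\<close>, and \<open>h1 \<le> h / 2\<close> gives
        \<open>h1 \<le> 2 ^ n * h'\<close> for the induction hypothesis.\<close>
      obtain h1 where h1: "h1 \<in> H" "\<sigma> * h \<le> h1" "h1 \<le> h / 2"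
        using step[of "h / 2"] Suc.prems h by (auto simp: \<sigma>_def)
      have "d h h' \<le> d h h1 + d h1 h'" using Suc.prems h1 by (intro tri)
      also have "d h h1 \<le> D' * h powr \<beta>" using Suc.prems h1 h by (intro direct) auto
      also have "d h1 h' \<le> E * h1 powr \<beta>"
        using Suc.prems h1 h False by (intro Suc.IH) auto
      also have "E * h1 powr \<beta> \<le> E * (h * (1 / 2)) powr \<beta>"
        using h1 pos[OF h1(1)] E \<alpha> by (intro mult_left_mono powr_mono2) (auto simp: \<beta>_def)
      also have "\<dots> = \<theta> * E * h powr \<beta>" using h by (simp add: \<theta>_def powr_mult del: times_divide_eq_right)
      finally have "d h h' \<le> (D' + \<theta> * E) * h powr \<beta>" by (simp add: algebra_simps)
      then show ?thesis by (simp add: E)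
    qed
  qed
  moreover have "\<exists>n. h \<le> 2 ^ n * h'" if "h' \<in> H" for h h'
  proof -
    obtain n where "h / h' < 2 ^ n" using real_arch_pow[of 2] by auto
    then show ?thesis using pos[OF that] by (auto simp: field_simps intro!: exI[of _ n])
  qed
  ultimately have "\<forall>h\<in>H. \<forall>h'\<in>H. h' \<le> h \<longrightarrow> h < h0 \<longrightarrow> d h h' \<le> E * h powr (\<kappa> - \<alpha>)"
    unfolding \<beta>_def by meson
  then show ?thesis using E(3) h0 by blast
qed

text \<open>A geometrically decaying sequence of mesh parameters has summable increments and hence a
  limit. Letting the finer parameter run along this sequence in the Cauchy estimate carries the rate
  over to every small \<open>h\<close> in \<open>H\<close>.\<close>

lemma mesh_family_converges:
  fixes v :: "real \<Rightarrow> plane \<Rightarrow> 'b::euclidean_space"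
  assumes M: "finite_measure M" and mesh: "mesh_parameters H" and \<beta>: "0 < \<beta>"
    and v: "\<And>h. h \<in> H \<Longrightarrow> v h \<in> L2 M" and E: "0 \<le> E" and h0: "0 < h0"
    and Cauchy: "\<And>h h'. h \<in> H \<Longrightarrow> h' \<in> H \<Longrightarrow> h' \<le> h \<Longrightarrow> h < h0 \<Longrightarrow>
      l2_norm M (\<lambda>z. v h z - v h' z) \<le> E * h powr \<beta>"
  shows "\<exists>w\<in>L2 M. \<forall>h\<in>H. h < h0 \<longrightarrow> l2_norm M (\<lambda>z. v h z - w z) \<le> E * h powr \<beta>"
proof -
  \<comment> \<open>Below \<open>h0\<close> the Cauchy estimate applies; below
    \<open>(1 / 2) ^ k\<close> it makes the increments summable.\<close>
  have "\<exists>h\<in>H. h < min h0 ((1 / 2) ^ k)" for k :: nat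
    using h0 by (intro mesh_parameters_small[OF mesh]) simp
  then obtain \<eta> where \<eta>: "\<And>k. \<eta> k \<in> H" "\<And>k. \<eta> k < h0" "\<And>k::nat. \<eta> k < (1 / 2) ^ k"
    by (metis min_less_iff_conj)
  have pos: "h > 0" if "h \<in> H" for h
    using mesh that by (auto simp: mesh_parameters_def)
  \<comment> \<open>The sequence \<open>\<eta>\<close> need not be decreasing, so the estimate is
    needed for either order of the parameters.\<close>
  have sym: "l2_norm M (\<lambda>z. v h z - v h' z) \<le> E * (max h h') powr \<beta>"
    if "h \<in> H" "h' \<in> H" "h < h0" "h' < h0" for h h'
    using Cauchy[of h h'] Cauchy[of h' h] that l2_norm_minus_commute[of M "v h" "v h'"]
    by (cases "h' \<le> h") (auto simp: max_def)
  have "summable (\<lambda>k. l2_norm M (\<lambda>z. v (\<eta> k) z - v (\<eta> (Suc k)) z))"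
  proof (rule summable_comparison_test')
    show "summable (\<lambda>k. E * ((1 / 2) powr \<beta>) ^ k)"
      using \<beta> powr_less_mono2[of \<beta> "1 / 2" 1] by (intro summable_mult summable_geometric) auto
    fix k
    have "max (\<eta> k) (\<eta> (Suc k)) \<le> (1 / 2) ^ k"
      using \<eta>(3)[of k] \<eta>(3)[of "Suc k"] power_decreasing[of k "Suc k" "1 / 2 :: real"] by linarith
    then have "(max (\<eta> k) (\<eta> (Suc k))) powr \<beta> \<le> ((1 / 2) ^ k) powr \<beta>"
      using \<beta> pos[OF \<eta>(1)[of k]] by (intro powr_mono2) auto
    also have "\<dots> = ((1 / 2) powr \<beta>) ^ k"
      by (simp add: powr_powr mult.commute flip: powr_realpow)
    finally have "E * (max (\<eta> k) (\<eta> (Suc k))) powr \<beta> \<le> E * ((1 / 2) powr \<beta>) ^ k"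
      using E by (rule mult_left_mono)
    then show "norm (l2_norm M (\<lambda>z. v (\<eta> k) z - v (\<eta> (Suc k)) z)) \<le> E * ((1 / 2) powr \<beta>) ^ k"
      using sym[OF \<eta>(1) \<eta>(1) \<eta>(2) \<eta>(2), of k "Suc k"] by (simp add: l2_norm_nonneg)
  qed
  then obtain w where w: "w \<in> L2 M" and lim: "(\<lambda>k. l2_norm M (\<lambda>z. v (\<eta> k) z - w z)) \<longlonglongrightarrow> 0"
    using L2_convergent_if_summable[OF M, of "\<lambda>k. v (\<eta> k)"] v \<eta>(1) by auto
  have "\<eta> \<longlonglongrightarrow> 0"
  proof (rule tendsto_sandwich[OF _ _ tendsto_const])
    show "(\<lambda>k. (1 / 2 :: real) ^ k) \<longlonglongrightarrow> 0" by (rule LIMSEQ_power_zero) simp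
  qed (use \<eta> pos in \<open>auto intro!: eventuallyI less_imp_le\<close>)
  \<comment> \<open>Here \<open>h\<close> stays fixed while \<open>\<eta> k\<close> tends to 0; the
    Cauchy bound depends on \<open>h\<close> only.\<close>
  have "l2_norm M (\<lambda>z. v h z - w z) \<le> E * h powr \<beta>" if h: "h \<in> H" "h < h0" for h
  proof (rule tendsto_lowerbound)
    show "(\<lambda>k. E * h powr \<beta> + l2_norm M (\<lambda>z. v (\<eta> k) z - w z)) \<longlonglongrightarrow> E * h powr \<beta>"
      using tendsto_add[OF tendsto_const lim] by simp
    have "\<forall>\<^sub>F k in sequentially. \<eta> k < h"
      using \<open>\<eta> \<longlonglongrightarrow> 0\<close> pos[OF h(1)] by (rule order_tendstoD)
    then show "\<forall>\<^sub>F k in sequentially. l2_norm M (\<lambda>z. v h z - w z)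
        \<le> E * h powr \<beta> + l2_norm M (\<lambda>z. v (\<eta> k) z - w z)"
    proof (rule eventually_mono)
      fix k assume "\<eta> k < h"
      then show "l2_norm M (\<lambda>z. v h z - w z) \<le> E * h powr \<beta> + l2_norm M (\<lambda>z. v (\<eta> k) z - w z)"
        using l2_norm_diff_triangle[OF v[OF h(1)] v[OF \<eta>(1)[of k]] w] Cauchy[of h "\<eta> k"] h \<eta>(1)[of k]
        by simp
    qed
  qed simp
  with w show ?thesis by blast
qed

section \<open>Cauchy estimate for the discrete fluxes and their convergence rate\<close>

theorem theorem5p10:
  fixes \<Omega> \<Gamma>I \<Gamma>C :: "plane set"
    and f :: "real \<Rightarrow> plane"
    and r g uhat q \<psi> :: "plane \<Rightarrow> real"
    and H :: "real set"
    and U VC VI :: "real \<Rightarrow> (plane \<Rightarrow> real) set"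
    and u qh \<psi>h :: "real \<Rightarrow> plane \<Rightarrow> real"
    and C c \<kappa> \<alpha> :: real
  assumes domain: "open \<Omega>" "bounded \<Omega>" "simply_connected \<Omega>" "lipschitz_boundary \<Omega>"
    and split: "boundary_split \<Omega> \<Gamma>I \<Gamma>C"
    and flux: "locally_lipschitz_flux f"
    and data: "r \<in> L2 (lebesgue_on \<Omega>)" "g \<in> Linf (restrict_space (bd_measure \<Omega>) \<Gamma>I)"
    and sol: "weak_solution \<Omega> \<Gamma>I \<Gamma>C f r g uhat"
    and q: "helmholtz_decomp \<Omega> \<Gamma>I \<Gamma>C (f \<circ> uhat) q \<psi>"
    and mesh: "mesh_parameters H"
    and U: "\<And>h. h \<in> H \<Longrightarrow> fe_space (U h) \<and> U h \<subseteq> Linf (lebesgue_on \<Omega>)"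
    and VC: "\<And>h. h \<in> H \<Longrightarrow> fe_space (VC h) \<and> VC h \<subseteq> H10 \<Omega> \<Gamma>C"
    and VI: "\<And>h. h \<in> H \<Longrightarrow> fe_space (VI h) \<and> VI h \<subseteq> H10 \<Omega> \<Gamma>I"
    and minimizer: "\<And>h. h \<in> H \<Longrightarrow>
          is_arg_min (\<lambda>v. G_fun \<Omega> f (VC h) (VI h) v q) (\<lambda>v. v \<in> U h) (u h)"
    and decomp: "\<And>h. h \<in> H \<Longrightarrow> helmholtz_decomp \<Omega> \<Gamma>I \<Gamma>C (f \<circ> u h) (qh h) (\<psi>h h)"
    and constants: "C > 0" "c > 0" "\<kappa> > 0" "\<alpha> > 0" "\<kappa> > \<alpha>"
    and rate: "\<And>h. h \<in> H \<Longrightarrow>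
          dual_norm \<Omega> \<Gamma>C (\<lambda>\<phi>. dual_div \<Omega> (f \<circ> u h) \<phi> - data_functional \<Omega> \<Gamma>I f r g \<phi>)
            = ennreal (l2_norm (lebesgue_on \<Omega>) (\<lambda>z. grad \<Omega> (qh h) z - grad \<Omega> q z)) \<and>
          l2_norm (lebesgue_on \<Omega>) (\<lambda>z. grad \<Omega> (qh h) z - grad \<Omega> q z) \<le> C * h powr \<kappa>"
    and inf_sup: "\<And>h. h \<in> H \<Longrightarrow>
          inf_sup_const \<Omega> \<Gamma>C (flux_span f (U h)) \<ge> ennreal (c * h powr \<alpha>)"
    and nested: "nested_spaces \<Omega> H U"
  shows "\<exists>w \<in> L2 (lebesgue_on \<Omega>).
           ((\<lambda>h. l2_norm (lebesgue_on \<Omega>) (\<lambda>z. f (u h z) - w z)) \<longlongrightarrow> 0) (at 0 within H) \<and>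
           (\<lambda>h. l2_norm (lebesgue_on \<Omega>) (\<lambda>z. f (u h z) - w z))
             \<in> O[at 0 within H](\<lambda>h. h powr (\<kappa> - \<alpha>))"
proof -
  define M where "M = lebesgue_on \<Omega>"
  define \<beta> where "\<beta> = \<kappa> - \<alpha>"
  define v where "v = (\<lambda>h z. f (u h z))"
  have \<beta>: "\<beta> > 0" using constants by (simp add: \<beta>_def)
  have pos: "h > 0" if "h \<in> H" for h
    using mesh that by (auto simp: mesh_parameters_def)
  have M: "finite_measure M"
    unfolding M_def using domain by (intro finite_measure_lebesgue_on lmeasurable_open)
  have flux_L2: "(\<lambda>z. f (y z)) \<in> L2 M" if "y \<in> U h" "h \<in> H" for y h
    using flux_comp_L2[OF M locally_lipschitz_flux_continuous[OF flux]] U[OF that(2)] that(1)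
    by (auto simp: M_def)
  have u: "u h \<in> U h" if "h \<in> H" for h
    using minimizer[OF that] by (simp add: is_arg_min_def)
  have v_L2: "v h \<in> L2 M" if "h \<in> H" for h
    unfolding v_def using flux_L2[OF u[OF that] that] .
  have grad_q: "grad \<Omega> q \<in> L2 M"
    using q H10_subset_H1 by (auto simp: M_def helmholtz_decomp_def intro!: grad_L2)
  have grad_qh: "grad \<Omega> (qh h) \<in> L2 M" if "h \<in> H" for h
    using decomp[OF that] H10_subset_H1 by (auto simp: M_def helmholtz_decomp_def intro!: grad_L2)
  have estimate: "l2_norm M (\<lambda>z. v h z - v h' z) \<le> (2 * C / c) * h powr \<kappa> * h' powr - \<alpha>"
    if h: "h \<in> H" "h' \<in> H" "h' \<le> h" for h h'
  proof -
    obtain y where y: "y \<in> U h'" "AE z in M. u h z = y z"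
      using nested h u[OF h(1)] unfolding nested_spaces_def M_def by blast
    \<comment> \<open>Nestedness holds only up to null sets. Built from \<open>y\<close> instead of
      \<open>u h\<close>, this field belongs to the flux span of \<open>U h'\<close> as a function,
      while its norm and pairings are those of \<open>v h - v h'\<close>.\<close>
    let ?s = "\<lambda>z. f (y z) - v h' z"
    have fy: "(\<lambda>z. f (y z)) \<in> L2 M" using flux_L2[OF y(1) h(2)] .
    have s: "?s \<in> L2 M" "(\<lambda>z. v h z - v h' z) \<in> L2 M"
      using fy v_L2 h by (auto intro: L2_diff)
    have ae: "AE z in M. ?s z = v h z - v h' z"
      using y(2) by (rule AE_mp) (simp add: v_def)
    have norm_s: "l2_norm M ?s = l2_norm M (\<lambda>z. v h z - v h' z)"
      using s[THEN L2_measurable] ae by (rule l2_norm_cong_AE)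
    \<comment> \<open>Both gradient components are compared with the exact one,
      \<open>grad \<Omega> q\<close>.\<close>
    have "l2_norm M (\<lambda>z. grad \<Omega> (qh h) z - grad \<Omega> (qh h') z)
        \<le> l2_norm M (\<lambda>z. grad \<Omega> (qh h) z - grad \<Omega> q z)
          + l2_norm M (\<lambda>z. grad \<Omega> q z - grad \<Omega> (qh h') z)"
      by (intro l2_norm_diff_triangle grad_qh grad_q h)
    also have "\<dots> \<le> C * h powr \<kappa> + C * h' powr \<kappa>"
      using rate[OF h(1)] rate[OF h(2)] l2_norm_minus_commute[of M "grad \<Omega> q" "grad \<Omega> (qh h')"]
      by (simp add: M_def)
    \<comment> \<open>The coarser parameter \<open>h\<close> dominates both errors, as
      \<open>\<kappa>\<close> is positive.\<close>
    also have "C * h' powr \<kappa> \<le> C * h powr \<kappa>"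
      using h pos[OF h(2)] constants by (intro mult_left_mono powr_mono2) auto
    finally have X: "l2_norm M (\<lambda>z. grad \<Omega> (qh h) z - grad \<Omega> (qh h') z) \<le> 2 * C * h powr \<kappa>"
      by simp
    have "c * h' powr \<alpha> * l2_norm M ?s \<le> 2 * C * h powr \<kappa>"
      unfolding M_def
    proof (rule inf_sup_const_bound[OF inf_sup[OF h(2)]])
      have "(\<lambda>z. f (y z)) \<in> flux_span f (U h')" "v h' \<in> flux_span f (U h')"
        unfolding flux_span_def v_def using y(1) u[OF h(2)]
        by (auto intro!: fun_vs.span_base simp: comp_def)
      then have "(\<lambda>z. f (y z)) - v h' \<in> flux_span f (U h')"
        unfolding flux_span_def by (rule fun_vs.span_diff)
      then show "?s \<in> flux_span f (U h')" by (simp add: fun_diff_def)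
      show "0 \<le> 2 * C * h powr \<kappa>" using constants by simp
      fix p assume p: "p \<in> H10 \<Omega> \<Gamma>C"
      then have grad_p: "grad \<Omega> p \<in> L2 M"
        using H10_subset_H1 by (auto simp: M_def intro!: grad_L2)
      have "l2_inner M ?s (grad \<Omega> p) = l2_inner M (\<lambda>z. v h z - v h' z) (grad \<Omega> p)"
        unfolding l2_inner_def
      proof (rule integral_cong_AE)
        show "AE z in M. ?s z \<bullet> grad \<Omega> p z = (v h z - v h' z) \<bullet> grad \<Omega> p z"
          using ae by (rule AE_mp) simp
      qed (use s grad_p in \<open>auto intro: borel_measurable_integrable integrable_inner_L2\<close>)
      also have "\<bar>\<dots>\<bar> \<le> l2_norm M (\<lambda>z. grad \<Omega> (qh h) z - grad \<Omega> (qh h') z) * h1_norm \<Omega> p"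
        using helmholtz_decomp_diff_inner_le[OF decomp[OF h(1)] decomp[OF h(2)] _ _ p]
          v_L2[OF h(1)] v_L2[OF h(2)] by (simp add: M_def v_def comp_def)
      also have "\<dots> \<le> 2 * C * h powr \<kappa> * h1_norm \<Omega> p"
        using X by (intro mult_right_mono) (auto simp: h1_norm_def l2_norm_nonneg)
      finally show "\<bar>l2_inner (lebesgue_on \<Omega>) ?s (grad \<Omega> p)\<bar> \<le> 2 * C * h powr \<kappa> * h1_norm \<Omega> p"
        by (simp add: M_def)
    qed
    then show ?thesis
      using constants pos[OF h(2)] by (simp add: norm_s powr_minus field_simps)
  qed
  \<comment> \<open>The bound in \<open>estimate\<close> blows up as \<open>h'\<close> tends to 0
    with \<open>h\<close> fixed; chaining replaces it by one that is uniform in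
    \<open>h'\<close>.\<close>
  have "\<exists>E h0. 0 \<le> E \<and> 0 < h0 \<and> (\<forall>h\<in>H. \<forall>h'\<in>H. h' \<le> h \<longrightarrow> h < h0 \<longrightarrow>
      l2_norm M (\<lambda>z. v h z - v h' z) \<le> E * h powr (\<kappa> - \<alpha>))"
    by (rule mesh_parameters_chain[OF mesh constants(4,5), where D = "2 * C / c"])
      (use constants estimate in \<open>auto intro!: l2_norm_diff_triangle v_L2\<close>)
  then obtain E h0 where E: "0 \<le> E" "0 < h0" and Cauchy: "\<And>h h'. h \<in> H \<Longrightarrow> h' \<in> H \<Longrightarrow>
      h' \<le> h \<Longrightarrow> h < h0 \<Longrightarrow> l2_norm M (\<lambda>z. v h z - v h' z) \<le> E * h powr \<beta>"
    unfolding \<beta>_def by blast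
  obtain w where w: "w \<in> L2 M"
    and bound: "\<And>h. h \<in> H \<Longrightarrow> h < h0 \<Longrightarrow> l2_norm M (\<lambda>z. v h z - w z) \<le> E * h powr \<beta>"
    using mesh_family_converges[OF M mesh \<beta> v_L2 E Cauchy] by blast
  \<comment> \<open>The conjunct \<open>0 \<le> h\<close> is recorded because the limit of
    \<open>h powr \<beta>\<close> at 0 is taken for nonnegative bases.\<close>
  have ev: "\<forall>\<^sub>F h in at 0 within H. 0 \<le> h \<and> l2_norm M (\<lambda>z. v h z - w z) \<le> E * h powr \<beta>"
    unfolding eventually_at using E(2) bound pos by (intro exI[of _ h0]) (auto simp: less_imp_le)
  have "((\<lambda>h. l2_norm M (\<lambda>z. v h z - w z)) \<longlongrightarrow> 0) (at 0 within H)"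
  proof (rule tendsto_sandwich[OF _ _ tendsto_const])
    have "((\<lambda>h. h powr \<beta>) \<longlongrightarrow> 0) (at 0 within H)"
      using \<beta> ev by (intro tendsto_zero_powrI[OF tendsto_ident_at tendsto_const])
        (auto elim: eventually_mono)
    then show "((\<lambda>h. E * h powr \<beta>) \<longlongrightarrow> 0) (at 0 within H)"
      by (rule tendsto_mult_right_zero)
  qed (use ev in \<open>auto simp: l2_norm_nonneg elim: eventually_mono\<close>)
  moreover have "(\<lambda>h. l2_norm M (\<lambda>z. v h z - w z)) \<in> O[at 0 within H](\<lambda>h. h powr \<beta>)"
    by (rule bigoI[of _ E]) (use ev in \<open>auto simp: l2_norm_nonneg elim!: eventually_mono\<close>)
  ultimately show ?thesis
    using w unfolding M_def v_def \<beta>_def by blast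
qed

end
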